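(* Define, for positive integers $s,\ell$, $$f(s,\ell)=\begin{cases}1+\dfrac{1}{2+s/\ell} & \text{if } \ell\le s/2,\\[2mm] \dfrac54 & \text{if } s/2<\ell\le 5s/6,\\[2mm] 1+\dfrac{2}{3+6\ell/s} & \text{if } 5s/6<\ell.\end{cases}$$ There exist a deterministic online algorithm $A$ for the Restricted Grid Scheduling problem and an absolute constant $C>0$ such that for every integer $S\ge 2$, all positive integers $s,\ell$, and every admissible sequence of bins $\sigma$, letting $I$ consist of $s$ items of size $S$ and $\ell$ items of size $L=2S-1$, $$A(I,\sigma)\le f(s,\ell)\cdot \mathrm{OPT}(I,\sigma)+C\cdot S .$$
   Context: Restricted Grid Scheduling: fix an integer $S>1$, put $L=2S-1$ and $M=4S-3=2L-1$. A set (multiset) $I$ of items is given in advance, every item having size $S$ or $L$. Bins with integer sizes in $[S,M]$ arrive one at a time in a sequence $\sigma$; the sequence is admissible if it ends with at least as many bins of size $M$ as there are items (so all items can always be packed). A partial packing assigns some items to bins so that the total size of items in each bin is at most the bin size; a packing assigns all items. A (partial) packing is valid if every bin that receives no item is smaller than every unpacked item and smaller than every item packed in a later bin. The cost of a packing is the sum of the sizes of the bins that receive at least one item. $\mathrm{OPT}(I,\sigma)$ is the minimum cost of a valid packing of $I$ into $\sigma$. A deterministic online algorithm knows $I$ (hence $S$, $s$, $\ell$) in advance, sees the bins one at a time, must irrevocably decide which items go into the current bin before seeing the next one, and must produce a valid packing; $A(I,\sigma)$ denotes the cost of its packing. *)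

theory Defs
  imports Complex_Main
begin

text \<open>Restricted Grid Scheduling. Items have size S (small) or L = 2S-1 (large);
  bins have integer sizes in [S, M], M = 4S-3. Since there are only two item types,
  a (full) packing into the bin sequence sigma is a list p of pairs (a, b) of the same
  length as sigma: bin i receives a small items and b large items.\<close>

definition bigL :: "nat \<Rightarrow> nat" where "bigL S = 2 * S - 1"
definition bigM :: "nat \<Rightarrow> nat" where "bigM S = 4 * S - 3"

definition admissible :: "nat \<Rightarrow> nat \<Rightarrow> nat list \<Rightarrow> bool" where
  "admissible S n \<sigma> \<longleftrightarrow>
     (\<forall>x \<in> set \<sigma>. S \<le> x \<and> x \<le> bigM S) \<and>
     n \<le> length \<sigma> \<and> (\<forall>x \<in> set (drop (length \<sigma> - n) \<sigma>). x = bigM S)"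

text \<open>Valid packing of s items of size S and l items of size L into sigma.
  All items are packed, so the validity condition reads: every empty bin is smaller
  than every item packed in a later bin.\<close>
definition valid_packing :: "nat \<Rightarrow> nat \<Rightarrow> nat \<Rightarrow> nat list \<Rightarrow> (nat \<times> nat) list \<Rightarrow> bool" where
  "valid_packing S s l \<sigma> p \<longleftrightarrow>
     length p = length \<sigma> \<and>
     (\<forall>i < length \<sigma>. fst (p ! i) * S + snd (p ! i) * bigL S \<le> \<sigma> ! i) \<and>
     (\<Sum>i < length \<sigma>. fst (p ! i)) = s \<and>
     (\<Sum>i < length \<sigma>. snd (p ! i)) = l \<and>
     (\<forall>i < length \<sigma>. p ! i = (0, 0) \<longrightarrow>
        (\<forall>j. i < j \<and> j < length \<sigma> \<longrightarrow>
           (0 < fst (p ! j) \<longrightarrow> \<sigma> ! i < S) \<and>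
           (0 < snd (p ! j) \<longrightarrow> \<sigma> ! i < bigL S)))"

definition cost :: "nat list \<Rightarrow> (nat \<times> nat) list \<Rightarrow> nat" where
  "cost \<sigma> p = (\<Sum>i < length \<sigma>. if p ! i \<noteq> (0, 0) then \<sigma> ! i else 0)"

definition OPT :: "nat \<Rightarrow> nat \<Rightarrow> nat \<Rightarrow> nat list \<Rightarrow> nat" where
  "OPT S s l \<sigma> = (LEAST c. \<exists>p. valid_packing S s l \<sigma> p \<and> cost \<sigma> p = c)"

text \<open>A deterministic online algorithm is a function that, given S, the numbers s, l of
  small and large items (i.e. the item set I), and the prefix of bins seen so far
  (ending with the current bin), returns how many small and large items to put in
  the current bin. Its packing of sigma:\<close>
type_synonym online_alg = "nat \<Rightarrow> nat \<Rightarrow> nat \<Rightarrow> nat list \<Rightarrow> nat \<times> nat"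

definition alg_packing :: "online_alg \<Rightarrow> nat \<Rightarrow> nat \<Rightarrow> nat \<Rightarrow> nat list \<Rightarrow> (nat \<times> nat) list" where
  "alg_packing A S s l \<sigma> = map (\<lambda>i. A S s l (take (Suc i) \<sigma>)) [0..<length \<sigma>]"

definition ratio_f :: "nat \<Rightarrow> nat \<Rightarrow> real" where
  "ratio_f s l =
     (if real l \<le> real s / 2 then 1 + 1 / (2 + real s / real l)
      else if real l \<le> 5 * real s / 6 then 5 / 4
      else 1 + 2 / (3 + 6 * real l / real s))"

end

theory Submission
  imports Defs
begin

text \<open>
  The algorithm packs large items first until \<open>X \<approx> (f - 1)(s + 2l)/2\<close> of them are packed, then
  small items (two or three per bin) until about \<open>2X\<close> of them are left, then large items again.
  As long as both packings still have items of the relevant kinds, they use exactly the same bins,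
  so a difference in cost arises only after one side runs out of a size. At that moment the excess cost
  is controlled by the numbers of items left on the two sides: if the optimum runs out of small items
  first, each surplus item costs at most \<open>2S - 1\<close>; if the algorithm does, each surplus large
  item costs at most \<open>4S - 3\<close>, minus \<open>S\<close> for every small item that the optimum cannot
  pack together with a large one. Counting a large item as two small ones, the algorithm fills every bin maximally, which
  limits the surplus; the two thresholds then bound the excess by \<open>(2S - 1) X + O(S)\<close>, which
  is at most \<open>f - 1\<close> times the total volume \<open>sS + l(2S - 1) \<le> OPT\<close>, up to \<open>O(S)\<close>.
\<close>

section \<open>Valid packings as a recursion over the bins\<close>

fun packs :: "nat \<Rightarrow> nat \<Rightarrow> nat \<Rightarrow> nat list \<Rightarrow> (nat \<times> nat) list \<Rightarrow> bool" where
  "packs S a b [] [] \<longleftrightarrow> a = 0 \<and> b = 0"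
| "packs S a b (c # \<sigma>) ((u, v) # p) \<longleftrightarrow>
     u \<le> a \<and> v \<le> b \<and> u * S + v * bigL S \<le> c \<and>
     ((u, v) = (0, 0) \<longrightarrow> (0 < a \<longrightarrow> c < S) \<and> (0 < b \<longrightarrow> c < bigL S)) \<and>
     packs S (a - u) (b - v) \<sigma> p"
| "packs _ _ _ _ _ \<longleftrightarrow> False"

text \<open>Everything still unpacked goes into later bins, so some later bin receives a small item
  exactly when small items are left. This turns the look-ahead in the validity condition into a test
  on the counters \<open>a\<close> and \<open>b\<close>.\<close>

lemma valid_packing_Cons:
  "valid_packing S a b (c # \<sigma>) ((u, v) # p) \<longleftrightarrow>
     u \<le> a \<and> v \<le> b \<and> u * S + v * bigL S \<le> c \<and>
     ((u, v) = (0, 0) \<longrightarrow> (0 < a \<longrightarrow> c < S) \<and> (0 < b \<longrightarrow> c < bigL S)) \<and>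
     valid_packing S (a - u) (b - v) \<sigma> p" (is "?l \<longleftrightarrow> ?r")
proof (cases "length p = length \<sigma>")
  case len: True
  let ?n = "length \<sigma>"
  let ?A = "\<Sum>i<?n. fst (p ! i)" and ?B = "\<Sum>i<?n. snd (p ! i)"
  define ok where "ok i j \<longleftrightarrow> (0 < fst (p ! j) \<longrightarrow> \<sigma> ! i < S) \<and> (0 < snd (p ! j) \<longrightarrow> \<sigma> ! i < bigL S)"
    for i j
  have sums: "(\<Sum>i<length (c # \<sigma>). fst (((u, v) # p) ! i)) = u + ?A"
    "(\<Sum>i<length (c # \<sigma>). snd (((u, v) # p) ! i)) = v + ?B"
    by (simp_all add: sum.lessThan_Suc_shift del: sum.lessThan_Suc)
  have bnd: "(\<forall>i < length (c # \<sigma>). fst (((u, v) # p) ! i) * S + snd (((u, v) # p) ! i) * bigL S \<le> (c # \<sigma>) ! i)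
     \<longleftrightarrow> u * S + v * bigL S \<le> c \<and> (\<forall>i < ?n. fst (p ! i) * S + snd (p ! i) * bigL S \<le> \<sigma> ! i)"
    by (simp add: All_less_Suc2)
  have later: "(\<forall>j. Suc i < j \<and> j < Suc ?n \<longrightarrow> P (j - 1)) \<longleftrightarrow> (\<forall>j. i < j \<and> j < ?n \<longrightarrow> P j)" for i and P :: "nat \<Rightarrow> bool"
    by (metis Suc_less_eq2 diff_Suc_1 Suc_less_eq)
  have later0: "(\<forall>j. 0 < j \<and> j < Suc ?n \<longrightarrow> P (j - 1)) \<longleftrightarrow> (\<forall>j < ?n. P j)" for P :: "nat \<Rightarrow> bool"
    by (metis Suc_less_eq diff_Suc_1 gr0_conv_Suc)
  have emp: "(\<forall>i < length (c # \<sigma>). ((u, v) # p) ! i = (0, 0) \<longrightarrow>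
        (\<forall>j. i < j \<and> j < length (c # \<sigma>) \<longrightarrow>
           (0 < fst (((u, v) # p) ! j) \<longrightarrow> (c # \<sigma>) ! i < S) \<and>
           (0 < snd (((u, v) # p) ! j) \<longrightarrow> (c # \<sigma>) ! i < bigL S)))
     \<longleftrightarrow> ((u, v) = (0, 0) \<longrightarrow> (\<forall>j < ?n. (0 < fst (p ! j) \<longrightarrow> c < S) \<and> (0 < snd (p ! j) \<longrightarrow> c < bigL S)))
       \<and> (\<forall>i < ?n. p ! i = (0, 0) \<longrightarrow> (\<forall>j. i < j \<and> j < ?n \<longrightarrow> ok i j))"
    unfolding list.size(4) add_Suc_right add_0_right All_less_Suc2
    using later0[of "\<lambda>j. (0 < fst (p ! j) \<longrightarrow> c < S) \<and> (0 < snd (p ! j) \<longrightarrow> c < bigL S)"]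
      later[of i "ok i" for i]
    by (auto simp: nth_Cons' ok_def)
  have pos: "0 < ?A \<longleftrightarrow> (\<exists>j < ?n. 0 < fst (p ! j))" "0 < ?B \<longleftrightarrow> (\<exists>j < ?n. 0 < snd (p ! j))"
    by (metis (no_types, lifting) finite_lessThan gr_zeroI lessThan_iff less_numeral_extra(3) sum_eq_0_iff)+
  show ?thesis
    unfolding valid_packing_def sums bnd emp
    using len pos by (auto simp: ok_def)
next
  case False
  then show ?thesis by (simp add: valid_packing_def)
qed

lemma valid_packing_iff_packs: "valid_packing S a b \<sigma> p \<longleftrightarrow> packs S a b \<sigma> p"
proof (induction \<sigma> arbitrary: p a b)
  case Nil
  show ?case by (cases p) (auto simp: valid_packing_def)
next
  case (Cons c \<sigma>)
  show ?case
  proof (cases p)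
    case Nil
    then show ?thesis by (simp add: valid_packing_def)
  next
    case p: (Cons q p')
    show ?thesis using Cons.IH by (cases q) (simp add: p valid_packing_Cons)
  qed
qed

lemma cost_Nil [simp]: "cost [] p = 0"
  by (simp add: cost_def)

lemma cost_Cons [simp]: "cost (c # \<sigma>) (q # p) = (if q \<noteq> (0, 0) then c else 0) + cost \<sigma> p"
  by (simp add: cost_def sum.lessThan_Suc_shift del: sum.lessThan_Suc cong: if_cong)

lemma packs_volume: "packs S a b \<sigma> p \<Longrightarrow> a * S + b * bigL S \<le> cost \<sigma> p"
proof (induction S a b \<sigma> p rule: packs.induct)
  case (2 S a b c \<sigma> u v p)
  then have IH: "(a - u) * S + (b - v) * bigL S \<le> cost \<sigma> p" and le: "u \<le> a" "v \<le> b" "u * S + v * bigL S \<le> c"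
    by simp_all
  have "a * S = (a - u) * S + u * S" "b * bigL S = (b - v) * bigL S + v * bigL S"
    using le by (simp_all flip: add_mult_distrib)
  then show ?case using IH le by (cases "u = 0 \<and> v = 0") simp_all
qed simp_all

section \<open>Possible contents of one bin\<close>

text \<open>The sizes \<open>2 * S - 1\<close> and \<open>3 * S - 1\<close> stand alone because
  there a large item fits while two small ones in its place would not. The conjunct
  \<open>3 \<le> S\<close> keeps the fact that no bin reaches \<open>3 * S\<close> when
  \<open>S = 2\<close>.\<close>

definition shape :: "nat \<Rightarrow> nat \<Rightarrow> nat \<Rightarrow> nat \<Rightarrow> bool" where
  "shape S c u v \<longleftrightarrow>
    c < 2 * S - 1 \<and> u \<le> 1 \<and> v = 0 \<or>
    c = 2 * S - 1 \<and> u + v \<le> 1 \<or>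
    2 * S \<le> c \<and> c < 3 * S - 1 \<and> u + 2 * v \<le> 2 \<or>
    c = 3 * S - 1 \<and> u + v \<le> 2 \<and> v \<le> 1 \<or>
    3 * S \<le> c \<and> 3 \<le> S \<and> u + 2 * v \<le> 3 \<and> v \<le> 1"

text \<open>Two large items need \<open>4 * S - 2\<close> and four small ones \<open>4 * S\<close>,
  both more than \<open>bigM S\<close>; the few remaining pairs are a linear case check.\<close>

lemma shape_of_fit:
  assumes "u * S + v * bigL S \<le> c" "2 \<le> S" "S \<le> c" "c \<le> bigM S"
  shows "shape S c u v"
proof -
  have M: "c < 4 * S - 2" using assms by (simp add: bigM_def)
  have u: "k * S \<le> u * S" if "k \<le> u" for k using that by simp
  have v: "k * (2 * S - 1) \<le> v * (2 * S - 1)" if "k \<le> v" for k using that by simp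
  have uv: "u * S + v * (2 * S - 1) \<le> c" using assms by (simp add: bigL_def)
  have v1: "v \<le> 1"
  proof (rule ccontr)
    assume "\<not> v \<le> 1"
    then have "2 * (2 * S - 1) \<le> v * (2 * S - 1)" by (intro v) simp
    then show False using uv M by linarith
  qed
  have u3: "u \<le> 3"
  proof (rule ccontr)
    assume "\<not> u \<le> 3"
    then have "4 * S \<le> u * S" by (intro u) simp
    then show False using uv M by linarith
  qed
  have "v = 0 \<or> v = 1" "u = 0 \<or> u = 1 \<or> u = 2 \<or> u = 3" using v1 u3 by auto
  then show ?thesis using uv M assms(2,3)
    by (elim disjE; simp add: shape_def; presburger)
qed

section \<open>The online algorithm and the validity of its packing\<close>

text \<open>The phase in which small items are preferred. The margin 3 ensures that more than
  \<open>2 * X\<close> of them remain even after a bin takes three.\<close>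

definition take_small :: "nat \<Rightarrow> nat \<Rightarrow> nat \<Rightarrow> nat \<Rightarrow> bool" where
  "take_small l X a b \<longleftrightarrow> b + X \<le> l \<and> 2 * X + 3 < a"

text \<open>Counting a large item as two small ones, each bin gets the maximal weight its size
  allows while both kinds last; \<open>take_small\<close> decides only where a large item and two
  small ones are interchangeable.\<close>

definition step :: "nat \<Rightarrow> nat \<Rightarrow> nat \<Rightarrow> nat \<Rightarrow> nat \<Rightarrow> nat \<Rightarrow> nat \<times> nat" where
  "step S l X a b c =
    (if b = 0 \<or> c < 2 * S - 1 then (min a (c div S), 0)
     else if c = 2 * S - 1 then (0, 1)
     else if c < 3 * S - 1 then (if take_small l X a b then (2, 0) else (0, 1))
     else if 3 * S \<le> c \<and> take_small l X a b then (3, 0)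
     else (min a 1, 1))"

fun run :: "nat \<Rightarrow> nat \<Rightarrow> nat \<Rightarrow> nat \<Rightarrow> nat \<Rightarrow> nat list \<Rightarrow> (nat \<times> nat) list" where
  "run S l X a b [] = []"
| "run S l X a b (c # \<sigma>) =
     step S l X a b c # run S l X (a - fst (step S l X a b c)) (b - snd (step S l X a b c)) \<sigma>"

lemma div_small:
  fixes S c :: nat
  assumes "2 \<le> S" "S \<le> c" "c \<le> bigM S"
  shows "c < 2 * S \<and> c div S = 1 \<or> 2 * S \<le> c \<and> c < 3 * S \<and> c div S = 2 \<or> 3 * S \<le> c \<and> c div S = 3"
proof -
  have M: "c < 4 * S" using assms by (simp add: bigM_def)
  have "c div S = k" if "k * S \<le> c" "c < Suc k * S" for k
    using that by (simp add: div_nat_eqI mult.commute)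
  from this[of 1] this[of 2] this[of 3] assms M show ?thesis
    by (cases "c < 2 * S"; cases "c < 3 * S") simp_all
qed

lemma step_cases:
  assumes "2 \<le> S" "S \<le> c" "c \<le> bigM S" "step S l X a b c = (u, v)"
  shows "u \<le> a \<and> v \<le> b \<and>
   (b = 0 \<and> v = 0 \<and> u = min a (c div S) \<or>
    0 < b \<and> c < 2 * S - 1 \<and> u = min a 1 \<and> v = 0 \<or>
    0 < b \<and> c = 2 * S - 1 \<and> u = 0 \<and> v = 1 \<or>
    0 < b \<and> 2 * S \<le> c \<and> c < 3 * S - 1 \<and> take_small l X a b \<and> u = 2 \<and> v = 0 \<or>
    0 < b \<and> 2 * S \<le> c \<and> c < 3 * S - 1 \<and> \<not> take_small l X a b \<and> u = 0 \<and> v = 1 \<or>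
    0 < b \<and> c = 3 * S - 1 \<and> u = min a 1 \<and> v = 1 \<or>
    0 < b \<and> 3 * S \<le> c \<and> take_small l X a b \<and> u = 3 \<and> v = 0 \<or>
    0 < b \<and> 3 * S \<le> c \<and> \<not> take_small l X a b \<and> u = min a 1 \<and> v = 1)"
  using assms(4) assms(1,2) div_small[OF assms(1-3)]
  by (auto simp: step_def take_small_def split: if_splits)

text \<open>Every bin of size \<open>bigM S\<close> receives an item while any are left, so the
  number of such bins still to come stays at least the number of items left, and nothing is left at
  the end.\<close>

lemma run_packs:
  assumes "2 \<le> S" "\<forall>c \<in> set \<sigma>. S \<le> c \<and> c \<le> bigM S" "a + b \<le> count_list \<sigma> (bigM S)"
  shows "packs S a b \<sigma> (run S l X a b \<sigma>)"
  using assms(2,3)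
proof (induction \<sigma> arbitrary: a b)
  case Nil
  then show ?case by simp
next
  case (Cons c \<sigma>)
  obtain u v where st: "step S l X a b c = (u, v)" by fastforce
  have c: "S \<le> c" "c \<le> bigM S" using Cons.prems by auto
  note cs = step_cases[OF assms(1) c st] and dv = div_small[OF assms(1) c]
  have prog: "c = bigM S \<longrightarrow> a + b = 0 \<or> 0 < u + v"
    using cs dv assms(1) by (auto simp: bigM_def take_small_def)
  have fit: "u * S + v * bigL S \<le> c"
  proof -
    have "min a (c div S) * S \<le> c"
      by (metis div_times_less_eq_dividend le_trans min.cobounded2 mult_le_mono1)
    have alts: "u = min a (c div S) \<and> v = 0 \<or> u \<le> 1 \<and> v = 0 \<or> u = 0 \<and> v = 1 \<and> 2 * S \<le> Suc c \<or>
      u = 2 \<and> v = 0 \<and> 2 * S \<le> c \<or> u \<le> 1 \<and> v = 1 \<and> 3 * S \<le> Suc c \<or> u = 3 \<and> v = 0 \<and> 3 * S \<le> c"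
      using cs assms(1) by (elim conjE disjE; simp; presburger)
    have one: "u * S \<le> S" if "u \<le> 1"
      using mult_le_mono1[OF that, of S] by simp
    from alts consider "u = min a (c div S)" "v = 0" | "u \<le> 1" "v = 0" | "u = 0" "v = 1" "2 * S \<le> Suc c"
      | "u = 2" "v = 0" "2 * S \<le> c" | "u \<le> 1" "v = 1" "3 * S \<le> Suc c" | "u = 3" "v = 0" "3 * S \<le> c"
      by blast
    then show ?thesis
    proof cases
      case 2
      then show ?thesis using le_trans[OF one[OF 2(1)] c(1)] by simp
    next
      case 5
      then show ?thesis using one[OF 5(1)] unfolding bigL_def 5(2) by linarith
    qed (simp_all add: bigL_def \<open>min a (c div S) * S \<le> c\<close>)
  qed
  have emp: "(u, v) = (0, 0) \<longrightarrow> (0 < a \<longrightarrow> c < S) \<and> (0 < b \<longrightarrow> c < bigL S)"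
    using cs dv c assms(1) by (auto simp: bigL_def)
  have "packs S (a - u) (b - v) \<sigma> (run S l X (a - u) (b - v) \<sigma>)"
    using Cons.prems prog cs by (intro Cons.IH) (auto split: if_splits)
  then show ?case using cs fit emp by (simp add: st)
qed

lemma take_run: "take k (run S l X a b \<sigma>) = run S l X a b (take k \<sigma>)"
  by (induction \<sigma> arbitrary: a b k) (auto simp: take_Cons split: nat.split)

lemma length_run [simp]: "length (run S l X a b \<sigma>) = length \<sigma>"
  by (induction \<sigma> arbitrary: a b) auto

text \<open>The online decision replays the run on the prefix seen so far and returns its last
  entry; by \<open>take_run\<close> this agrees with the run on the whole sequence.\<close>

lemma alg_packing_run:
  "alg_packing (\<lambda>S s l \<sigma>. last (run S l (X s l) s l \<sigma>)) S s l \<sigma> = run S l (X s l) s l \<sigma>"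
proof (rule nth_equalityI)
  fix i assume i: "i < length (alg_packing (\<lambda>S s l \<sigma>. last (run S l (X s l) s l \<sigma>)) S s l \<sigma>)"
  then have "i < length \<sigma>" by (simp add: alg_packing_def)
  then show "alg_packing (\<lambda>S s l \<sigma>. last (run S l (X s l) s l \<sigma>)) S s l \<sigma> ! i = run S l (X s l) s l \<sigma> ! i"
    by (simp add: alg_packing_def take_Suc_conv_app_nth flip: take_run)
qed (simp add: alg_packing_def)

section \<open>Cost comparison after one side has run out of a size\<close>

lemma cost_run_done [simp]: "cost \<sigma> (run S l X 0 0 \<sigma>) = 0"
  by (induction \<sigma>) (auto simp: step_def)

text \<open>A bin filled with \<open>c div S\<close> small items costs at most
  \<open>2 * S - 1\<close> per item. Only the last bin used may hold fewer, and \<open>2 * S\<close>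
  covers its excess.\<close>

lemma cost_run_small:
  assumes "2 \<le> S" "\<forall>c \<in> set \<sigma>. S \<le> c \<and> c \<le> bigM S"
  shows "int (cost \<sigma> (run S l X a 0 \<sigma>)) \<le> (2 * int S - 1) * int a + 2 * int S"
  using assms(2)
proof (induction \<sigma> arbitrary: a)
  case Nil
  have "0 \<le> (2 * int S - 1) * int a" using assms(1) by (intro mult_nonneg_nonneg) auto
  then show ?case by simp
next
  case (Cons c \<sigma>)
  obtain u v where st: "step S l X a 0 c = (u, v)" by fastforce
  have c: "S \<le> c" "c \<le> bigM S" using Cons.prems by auto
  note dv = div_small[OF assms(1) c]
  have uv: "u = min a (c div S)" "v = 0" using st by (auto simp: step_def)
  have IH: "int (cost \<sigma> (run S l X (a - u) 0 \<sigma>)) \<le> (2 * int S - 1) * int (a - u) + 2 * int S"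
    using Cons.prems by (intro Cons.IH) auto
  show ?case
  proof (cases "a < c div S")
    case True
    then have "u = a" using uv by simp
    show ?thesis
    proof (cases a)
      case 0
      then show ?thesis using uv st by simp
    next
      case (Suc a')
      have "(2 * int S - 1) * int a = (2 * int S - 1) + (2 * int S - 1) * int a'"
        by (simp add: Suc algebra_simps)
      moreover have "0 \<le> (2 * int S - 1) * int a'" using assms(1) by simp
      moreover have "int c \<le> 4 * int S - 3" using c assms(1) by (simp add: bigM_def)
      moreover have "int (cost (c # \<sigma>) (run S l X a 0 (c # \<sigma>))) \<le> int c"
        using \<open>u = a\<close> uv by (simp add: st)
      ultimately show ?thesis by linarith
    qed
  next
    case False
    then have u: "u = c div S" "u \<le> a" using uv by auto
    have "int c \<le> (2 * int S - 1) * int u"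
      using dv u c assms(1) by (auto simp: bigM_def)
    moreover have "(2 * int S - 1) * int (a - u) = (2 * int S - 1) * int a - (2 * int S - 1) * int u"
      using u by (simp add: of_nat_diff right_diff_distrib)
    ultimately show ?thesis using IH by (auto simp: st uv(2))
  qed
qed

lemma packs_ConsE:
  assumes "packs S a b (c # \<sigma>) p" "2 \<le> S" "S \<le> c" "c \<le> bigM S"
  obtains u v q where "p = (u, v) # q" "u \<le> a" "v \<le> b" "packs S (a - u) (b - v) \<sigma> q"
    "0 < a \<or> 0 < b \<and> 2 * S - 1 \<le> c \<longrightarrow> 0 < u + v" "shape S c u v"
proof -
  obtain u v q where p: "p = (u, v) # q" using assms(1) by (cases p) auto
  have fit: "u * S + v * bigL S \<le> c" using assms(1) p by simp
  have "0 < u + v" if "0 < a \<or> 0 < b \<and> 2 * S - 1 \<le> c"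
    using that assms p by (auto simp: bigL_def)
  then show thesis using that[of u v q] shape_of_fit[OF fit assms(2-4)] assms(1) p by simp
qed

text \<open>In a bin below \<open>2 * S - 1\<close> only the algorithm can pack, one small item for
  less than \<open>2 * S - 1\<close>. In a larger bin the optimum packs one large item and the
  algorithm at least one item, so \<open>a + b - b'\<close> does not grow. The last hypothesis
  ensures that the algorithm has only small items left when the optimum is done, so that
  \<open>cost_run_small\<close> applies.\<close>

lemma loss_opt_without_small:
  assumes "2 \<le> S" "\<forall>c \<in> set \<sigma>. S \<le> c \<and> c \<le> bigM S" "packs S 0 b' \<sigma> p"
    and "b = 0 \<or> a + 2 * b \<le> 2 * b'"
  shows "int (cost \<sigma> (run S l X a b \<sigma>))
    \<le> int (cost \<sigma> p) + (2 * int S - 1) * (int a + int b - int b') + 2 * int S"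
  using assms(2-4)
proof (induction \<sigma> arbitrary: a b b' p)
  case Nil
  then show ?case using assms(1) by (cases p) auto
next
  case (Cons c \<sigma>)
  let ?K = "2 * int S - 1"
  have c: "S \<le> c" "c \<le> bigM S" using Cons.prems by auto
  obtain x y q where p: "p = (x, y) # q" and le: "x \<le> 0" "y \<le> b'"
    and q: "packs S (0 - x) (b' - y) \<sigma> q"
    and ne: "0 < (0::nat) \<or> 0 < b' \<and> 2 * S - 1 \<le> c \<longrightarrow> 0 < x + y" and opt: "shape S c x y"
    using packs_ConsE[OF Cons.prems(2) assms(1) c] by blast
  have x: "x = 0" using le by simp
  have y: "y \<le> 1" "2 * S - 1 \<le> c \<Longrightarrow> 0 < b' \<Longrightarrow> y = 1" "c < 2 * S - 1 \<Longrightarrow> y = 0"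
    using opt ne x assms(1) by (auto simp: shape_def)
  obtain u v where st: "step S l X a b c = (u, v)" by fastforce
  note cs = step_cases[OF assms(1) c st] and dv = div_small[OF assms(1) c]
  show ?case
  proof (cases "b' = 0")
    case True
    then have b: "b = 0" using Cons.prems(3) by auto
    show ?thesis
      using cost_run_small[OF assms(1) Cons.prems(1), of l X a] True b by simp
  next
    case b': False
    have inv: "b - v = 0 \<or> (a - u) + 2 * (b - v) \<le> 2 * (b' - y)"
      using cs dv y b' Cons.prems(3) by auto
    have IH: "int (cost \<sigma> (run S l X (a - u) (b - v) \<sigma>))
      \<le> int (cost \<sigma> q) + ?K * (int (a - u) + int (b - v) - int (b' - y)) + 2 * int S"
      using Cons.prems(1) q x inv by (intro Cons.IH) auto
    show ?thesis
    proof (cases "c < 2 * S - 1")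
      case True
      have "y = 0" using y True by simp
      have uv: "v = 0" "u = min a 1" using cs dv True assms(1) by auto
      show ?thesis
      proof (cases a)
        case 0
        then show ?thesis using st IH \<open>y = 0\<close> uv p x by simp
      next
        case (Suc a')
        have "?K * (1 + int a' + int b - int b') = ?K + ?K * (int a' + int b - int b')"
          by (simp add: algebra_simps)
        then show ?thesis using st IH \<open>y = 0\<close> uv p x Suc True by simp
      qed
    next
      case False
      have y1: "y = 1" using y b' False by auto
      have "a = 0 \<and> b = 0 \<or> 0 < u + v"
        using cs dv False by auto
      then have "int (a - u) + int (b - v) - int (b' - y) \<le> int a + int b - int b' \<or> a = 0 \<and> b = 0"
        using cs y1 le by auto
      then show ?thesis
      proof
        assume "a = 0 \<and> b = 0"
        \<comment> \<open>The surplus is now \<open>- b'\<close>; the volume of the large items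
          still in \<open>p\<close> covers this negative term.\<close>
        have "b' * (2 * S - 1) \<le> cost (c # \<sigma>) p"
          using packs_volume[OF Cons.prems(2)] by (simp add: bigL_def)
        then have "int (b' * (2 * S - 1)) \<le> int (cost (c # \<sigma>) p)" by linarith
        then have "?K * int b' \<le> int (cost (c # \<sigma>) p)"
          using assms(1) by (simp add: of_nat_diff mult.commute)
        then show ?thesis
          using \<open>a = 0 \<and> b = 0\<close> cost_run_done[of "c # \<sigma>" S l X] by (simp del: cost_Cons run.simps cost_run_done)
      next
        assume le: "int (a - u) + int (b - v) - int (b' - y) \<le> int a + int b - int b'"
        have "?K * (int (a - u) + int (b - v) - int (b' - y)) \<le> ?K * (int a + int b - int b')"
          using assms(1) by (intro mult_left_mono le) auto
        moreover have "cost (c # \<sigma>) (run S l X a b (c # \<sigma>)) \<le> c + cost \<sigma> (run S l X (a - u) (b - v) \<sigma>)"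
          using st by auto
        moreover have "cost (c # \<sigma>) p = c + cost \<sigma> q" using p y1 by simp
        ultimately show ?thesis using IH by linarith
      qed
    qed
  qed
qed

text \<open>While \<open>a' > 0\<close> the optimum uses every bin and puts at most
  \<open>c div S\<close> items into it, as many as the algorithm packs unless it finishes there. So
  \<open>a - a' - b'\<close> does not grow, and at \<open>a' = 0\<close> the lemma
  \<open>loss_opt_without_small\<close> takes over.\<close>

lemma loss_run_without_large:
  assumes "2 \<le> S" "\<forall>c \<in> set \<sigma>. S \<le> c \<and> c \<le> bigM S" "packs S a' b' \<sigma> p"
  shows "int (cost \<sigma> (run S l X a 0 \<sigma>))
    \<le> int (cost \<sigma> p) + max 0 ((2 * int S - 1) * (int a - int a' - int b')) + 2 * int S"
  using assms(2,3)
proof (induction \<sigma> arbitrary: a a' b' p)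
  case Nil
  then show ?case by (cases p) auto
next
  case (Cons c \<sigma>)
  let ?K = "2 * int S - 1"
  have c: "S \<le> c" "c \<le> bigM S" using Cons.prems by auto
  show ?case
  proof (cases "a' = 0")
    case True
    then show ?thesis
      using loss_opt_without_small[OF assms(1) Cons.prems(1), of b' p 0 a l X] Cons.prems(2) by simp
  next
    case a': False
    obtain x y q where p: "p = (x, y) # q" and le: "x \<le> a'" "y \<le> b'"
      and q: "packs S (a' - x) (b' - y) \<sigma> q"
      and ne: "0 < a' \<or> 0 < b' \<and> 2 * S - 1 \<le> c \<longrightarrow> 0 < x + y" and opt: "shape S c x y"
      using packs_ConsE[OF Cons.prems(2) assms(1) c] by blast
    obtain u v where st: "step S l X a 0 c = (u, v)" by fastforce
    have uv: "u = min a (c div S)" "v = 0" using st by (auto simp: step_def)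
    have n: "x + y \<le> c div S"
      using opt div_small[OF assms(1) c] by (auto simp: shape_def)
    have pos: "0 < x + y" using ne a' by simp
    show ?thesis
    proof (cases "a < c div S")
      case True
      then show ?thesis using st uv pos p by simp
    next
      case False
      then have "int (a - u) - int (a' - x) - int (b' - y) \<le> int a - int a' - int b'"
        using uv n le by auto
      then have "?K * (int (a - u) - int (a' - x) - int (b' - y)) \<le> ?K * (int a - int a' - int b')"
        using assms(1) by (intro mult_left_mono) auto
      moreover have "int (cost \<sigma> (run S l X (a - u) 0 \<sigma>))
        \<le> int (cost \<sigma> q) + max 0 (?K * (int (a - u) - int (a' - x) - int (b' - y))) + 2 * int S"
        using Cons.prems(1) q by (intro Cons.IH) auto
      moreover have "cost (c # \<sigma>) (run S l X a 0 (c # \<sigma>)) \<le> c + cost \<sigma> (run S l X (a - u) 0 \<sigma>)"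
        using st uv by auto
      moreover have "cost (c # \<sigma>) p = c + cost \<sigma> q" using p pos by simp
      ultimately show ?thesis by linarith
    qed
  qed
qed

text \<open>A large item shares its bin with at most one small one, so at least
  \<open>a' - b'\<close> small items of the optimum go elsewhere. In bins too small for a large item
  only the optimum pays, at least \<open>S\<close> each; in larger bins they displace a large item,
  which lowers the surplus \<open>b - b'\<close>.\<close>

lemma loss_run_without_small:
  assumes "2 \<le> S" "\<forall>c \<in> set \<sigma>. S \<le> c \<and> c \<le> bigM S" "packs S a' b' \<sigma> p"
  shows "int (cost \<sigma> (run S l X 0 b \<sigma>))
    \<le> int (cost \<sigma> p) + max 0 ((4 * int S - 3) * (int b - int b') - int S * max 0 (int a' - int b'))"
  using assms(2,3)
proof (induction \<sigma> arbitrary: b a' b' p)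
  case Nil
  then show ?case by (cases p) auto
next
  case (Cons c \<sigma>)
  let ?K = "4 * int S - 3"
  let ?m = "max 0 (int a' - int b')"
  have c: "S \<le> c" "c \<le> bigM S" using Cons.prems by auto
  obtain x y q where p: "p = (x, y) # q" and le: "x \<le> a'" "y \<le> b'"
    and q: "packs S (a' - x) (b' - y) \<sigma> q"
    and ne: "0 < a' \<or> 0 < b' \<and> 2 * S - 1 \<le> c \<longrightarrow> 0 < x + y" and opt: "shape S c x y"
    using packs_ConsE[OF Cons.prems(2) assms(1) c] by blast
  show ?case
  proof (cases b)
    case 0
    then show ?thesis
      using cost_run_done[of "c # \<sigma>" S l X] by (simp del: cost_Cons run.simps cost_run_done)
  next
    case b: (Suc b0)
    obtain u v where st: "step S l X 0 b c = (u, v)" by fastforce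
    note cs = step_cases[OF assms(1) c st]
    have uv: "u = 0" "v = (if c < 2 * S - 1 then 0 else 1)"
      using cs b by (auto simp: take_small_def)
    let ?m' = "max 0 (int (a' - x) - int (b' - y))"
    have IH: "int (cost \<sigma> (run S l X 0 (b - v) \<sigma>))
      \<le> int (cost \<sigma> q) + max 0 (?K * (int (b - v) - int (b' - y)) - int S * ?m')"
      using Cons.prems(1) q by (intro Cons.IH) auto
    have Sm: "int S * i \<le> int S * j" if "i \<le> j" for i j :: int
      using that by (intro mult_left_mono) auto
    show ?thesis
    proof (cases "c < 2 * S - 1")
      case True
      then have y: "y = 0" and x: "x \<le> 1" "x = 0 \<longrightarrow> a' = 0"
        using opt ne by (auto simp: shape_def)
      show ?thesis
      proof (cases "x = 0")
        case True
        then show ?thesis using st IH p uv \<open>c < 2 * S - 1\<close> y by simp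
      next
        case False
        then have "x = 1" using x by simp
        have "int S * ?m \<le> int S * (?m' + 1)"
          using \<open>x = 1\<close> y le by (intro Sm) auto
        also have "\<dots> \<le> int S * ?m' + int c" using c by (simp add: algebra_simps)
        finally have *: "int S * ?m \<le> int S * ?m' + int c" .
        have "max 0 (A - B') \<le> int c + max 0 (A - B)" if "B \<le> B' + int c" for A B B' :: int
          using that by simp
        note this[OF *, of "?K * (int (b - v) - int (b' - y))"]
        moreover have "cost (c # \<sigma>) (run S l X 0 b (c # \<sigma>)) = cost \<sigma> (run S l X 0 (b - v) \<sigma>)"
          using st uv \<open>c < 2 * S - 1\<close> by simp
        moreover have "cost (c # \<sigma>) p = c + cost \<sigma> q" using p \<open>x = 1\<close> by simp
        moreover have "b - v = b" "b' - y = b'" using uv y \<open>c < 2 * S - 1\<close> by simp_all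
        ultimately show ?thesis using IH by (simp only:)
      qed
    next
      case False
      then have v: "v = 1" using uv by simp
      show ?thesis
      proof (cases "x + y = 0")
        case True
        then have "a' = 0" "b' = 0" "x = 0" "y = 0" using ne False by auto
        have "?K * (1 + int b0) = ?K + ?K * int b0" by (simp add: algebra_simps)
        moreover have "int c \<le> ?K" using c assms(1) by (simp add: bigM_def)
        moreover have "0 \<le> ?K * int b0" using assms(1) by simp
        ultimately show ?thesis
          using st IH p uv v b \<open>a' = 0\<close> \<open>b' = 0\<close> \<open>x = 0\<close> \<open>y = 0\<close> by simp
      next
        case ne0: False
        have "?K * (int (b - v) - int (b' - y)) - int S * ?m' \<le> ?K * (int b - int b') - int S * ?m"
        proof (cases "y = 0")
          case True
          \<comment> \<open>Lowering the large surplus by one is worth \<open>4 * S - 3\<close>.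
            This pays for two small items always, and for three because three fit only when
            \<open>3 \<le> S\<close>.\<close>
          have x: "x \<le> 2 \<or> x \<le> 3 \<and> 3 \<le> S" using opt True by (auto simp: shape_def)
          have "int S * ?m \<le> int S * (?m' + int x)"
            using True le by (intro Sm) auto
          also have "\<dots> = int S * ?m' + int S * int x" by (simp add: algebra_simps)
          also have "int S * int x \<le> ?K"
          proof -
            have "int S * int x \<le> int S * 2 \<or> int S * int x \<le> int S * 3 \<and> 3 \<le> S"
              using x Sm[of "int x" 2] Sm[of "int x" 3] by linarith
            then show ?thesis using assms(1) by linarith
          qed
          finally have "int S * ?m \<le> int S * ?m' + ?K" by simp
          moreover have "?K * (int b0 - int b') = ?K * (int b - int b') - ?K"
            by (simp add: b algebra_simps)
          ultimately show ?thesis using True b v by simp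
        next
          case False
          then have y: "y = 1" "x \<le> 1" using opt by (auto simp: shape_def)
          have "int S * ?m \<le> int S * ?m'"
            using y le by (intro Sm) auto
          moreover have "int (b - v) - int (b' - y) = int b - int b'"
            using v y le b by auto
          ultimately show ?thesis by simp
        qed
        moreover have "cost (c # \<sigma>) (run S l X 0 b (c # \<sigma>)) \<le> c + cost \<sigma> (run S l X 0 (b - v) \<sigma>)"
          using st uv by auto
        moreover have "cost (c # \<sigma>) p = c + cost \<sigma> q" using p ne0 by simp
        ultimately show ?thesis using IH by linarith
      qed
    qed
  qed
qed

section \<open>Joint invariant and bound on the total excess\<close>

text \<open>Here \<open>d\<close> is the surplus of large items when the algorithm runs out of small ones; the
  \<open>max\<close> term is a lower bound for the number of small items that the optimum must then still
  pack into bins without a large item.\<close>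

definition good_threshold :: "nat \<Rightarrow> nat \<Rightarrow> nat \<Rightarrow> bool" where
  "good_threshold s l X \<longleftrightarrow> (\<forall>d::int. 0 \<le> d \<and> 2 * d + 2 * int X \<le> int s \<and> d + int X \<le> int l \<longrightarrow>
     4 * d \<le> 2 * int X + 6 + max 0 (3 * d - int l + int X))"

text \<open>The joint invariant: \<open>a, b\<close> are the small and large items left for the algorithm, and
  \<open>a', b'\<close> those left for the packing it is compared with.\<close>

definition balanced :: "nat \<Rightarrow> nat \<Rightarrow> nat \<Rightarrow> nat \<Rightarrow> nat \<Rightarrow> nat \<Rightarrow> nat \<Rightarrow> bool" where
  "balanced s l X a b a' b' \<longleftrightarrow>
     a + 2 * b \<le> a' + 2 * b' \<and> 2 * b + a \<le> s + 2 * b' \<and> a + 2 * b \<le> l + a' + b' \<and>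
     (b \<le> b' \<or> 2 * b + 2 * X \<le> s + 2 * b') \<and> (b \<le> b' \<or> b + X \<le> l) \<and>
     (a + b \<le> a' + b' + X \<or> a \<le> 2 * X + 3)"

lemma loss_terminal:
  assumes "2 \<le> S" "\<forall>c \<in> set \<sigma>. S \<le> c \<and> c \<le> bigM S" "packs S a' b' \<sigma> p"
    and thr: "good_threshold s l X" and inv: "balanced s l X a b a' b'"
    and exhausted: "a = 0 \<or> b = 0 \<or> a' = 0"
  shows "int (cost \<sigma> (run S l X a b \<sigma>)) \<le> int (cost \<sigma> p) + (2 * int S - 1) * (int X + 3) + 2 * int S"
proof -
  let ?K = "2 * int S - 1"
  have K: "?K * i \<le> ?K * j" if "i \<le> j" for i j
    using assms(1) that by (intro mult_left_mono) auto
  note i = inv[unfolded balanced_def]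
  consider "a' = 0" | "b = 0" | "a = 0" "b \<noteq> 0" using exhausted by blast
  then show ?thesis
  proof cases
    case 1
    \<comment> \<open>The invariant bounds the surplus by \<open>X\<close> or gives
      \<open>a \<le> 2 * X + 3\<close>; then \<open>a + 2 * b \<le> 2 * b'\<close> yields
      \<open>2 * (a + b - b') \<le> a\<close>. In the next case \<open>a \<le> a' + 2 * b'\<close>
      plays the same part.\<close>
    have "int a + int b - int b' \<le> int X + 3"
      using i 1 by linarith
    from K[OF this] show ?thesis
      using loss_opt_without_small[OF assms(1,2), of b' p b a l X] assms(3) i 1 by auto
  next
    case 2
    have "int a - int a' - int b' \<le> int X + 3"
      using i 2 by linarith
    from K[OF this] have "max 0 (?K * (int a - int a' - int b')) \<le> ?K * (int X + 3)"
      using assms(1) by simp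
    then show ?thesis
      using loss_run_without_large[OF assms(1-3), of l X a] unfolding 2 by linarith
  next
    case 3
    let ?d = "int b - int b'" and ?m = "max 0 (int a' - int b')"
    have "(4 * int S - 3) * ?d - int S * ?m \<le> ?K * (int X + 3)"
    proof (cases "b \<le> b'")
      case True
      have "(4 * int S - 3) * ?d \<le> 0"
        using True assms(1) by (intro mult_nonneg_nonpos) auto
      moreover have "0 \<le> int S * ?m" by simp
      moreover have "0 \<le> ?K * (int X + 3)" using assms(1) by (intro mult_nonneg_nonneg) auto
      ultimately show ?thesis by linarith
    next
      case False
      then have d: "0 \<le> ?d" "2 * ?d + 2 * int X \<le> int s" "?d + int X \<le> int l" using i by auto
      let ?e = "max 0 (3 * ?d - int l + int X)"
      have num: "4 * ?d \<le> 2 * int X + 6 + ?e"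
        using thr d unfolding good_threshold_def by blast
      \<comment> \<open>As \<open>a = 0\<close>, the weight inequality gives
        \<open>2 * ?d \<le> a'\<close>, and \<open>b + X \<le> l\<close> gives
        \<open>b' \<le> l - X - ?d\<close>.\<close>
      have "3 * ?d - int l + int X \<le> int a' - int b'" using i 3 False by auto
      then have em: "?e \<le> ?m" "0 \<le> ?m" by simp_all
      have drop: "P - 2 * D - m \<le> P" if "0 \<le> D" "0 \<le> m" for P D m :: int
        using that by linarith
      \<comment> \<open>Here \<open>4 * S - 3 = 2 * ?K - 1\<close> and
        \<open>2 * S = ?K + 1\<close>; doubling isolates \<open>4 * ?d - ?m\<close>, which
        \<open>good_threshold\<close> controls.\<close>
      have "2 * ((4 * int S - 3) * ?d - int S * ?m) = ?K * (4 * ?d - ?m) - 2 * ?d - ?m"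
        by (simp add: algebra_simps)
      also have "\<dots> \<le> ?K * (4 * ?d - ?m)" by (rule drop[OF d(1) em(2)])
      also have "\<dots> \<le> ?K * (2 * int X + 6)" using num em by (intro K) linarith
      also have "\<dots> = 2 * (?K * (int X + 3))" by (simp add: algebra_simps)
      finally show ?thesis by (simp only: mult_le_cancel_left_pos zero_less_numeral)
    qed
    moreover have "0 \<le> ?K * (int X + 3)" using assms(1) by (intro mult_nonneg_nonneg) auto
    ultimately have "max 0 ((4 * int S - 3) * ?d - int S * ?m) \<le> ?K * (int X + 3)" by (rule_tac max.boundedI)
    then show ?thesis
      using loss_run_without_small[OF assms(1-3), of l X b] unfolding 3 by linarith
  qed
qed

text \<open>Maximal filling keeps the algorithm from falling behind in weight. It can fall behind in
  large items only while \<open>take_small\<close> holds, and in the number of items only while it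
  fails.\<close>

lemma step_vs_shape:
  assumes "2 \<le> S" "S \<le> c" "c \<le> bigM S" "step S l X a b c = (u, v)" "shape S c x y" "0 < a" "0 < b"
  shows "x + 2 * y \<le> u + 2 * v" "v \<le> 1" "0 < u + v" "u \<le> a" "v \<le> b"
    "take_small l X a b \<and> v = 0 \<and> x + y \<le> u \<and> u \<le> 3 \<or> y \<le> v \<and> (x + y \<le> u + v \<or> \<not> take_small l X a b)"
proof -
  note cs = step_cases[OF assms(1-4)]
  have m: "min a 1 = 1" using assms(6) by simp
  show "u \<le> a" "v \<le> b" using cs by auto
  show "v \<le> 1" using cs by auto
  show "0 < u + v" using cs m assms(7) by auto
  show "x + 2 * y \<le> u + 2 * v"
    using cs assms(1,5,7) unfolding shape_def m by (elim conjE disjE) simp_all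
  show "take_small l X a b \<and> v = 0 \<and> x + y \<le> u \<and> u \<le> 3 \<or> y \<le> v \<and> (x + y \<le> u + v \<or> \<not> take_small l X a b)"
    using cs assms(1,5,7) unfolding shape_def m by (elim conjE disjE) simp_all
qed

text \<open>The surplus \<open>b - b'\<close> grows only under \<open>take_small\<close>, whose two
  conditions then bound it. The surplus in the number of items grows only when
  \<open>take_small\<close> fails: either fewer than \<open>X\<close> large items were packed, and
  the weight bound limits the surplus to \<open>X\<close>, or few small items are left.\<close>

lemma balanced_step:
  assumes "balanced s l X a b a' b'" "u \<le> a" "v \<le> b" "x \<le> a'" "y \<le> b'" "x + 2 * y \<le> u + 2 * v" "v \<le> 1"
    and "take_small l X a b \<and> v = 0 \<and> x + y \<le> u \<and> u \<le> 3 \<or> y \<le> v \<and> (x + y \<le> u + v \<or> \<not> take_small l X a b)"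
  shows "balanced s l X (a - u) (b - v) (a' - x) (b' - y)"
proof -
  obtain a2 b2 a2' b2' where eq: "a = a2 + u" "b = b2 + v" "a' = a2' + x" "b' = b2' + y"
    using assms(2-5) by (metis le_add_diff_inverse2)
  have i: "a2 + u + 2 * (b2 + v) \<le> a2' + x + 2 * (b2' + y)"
    "2 * (b2 + v) + (a2 + u) \<le> s + 2 * (b2' + y)"
    "a2 + u + 2 * (b2 + v) \<le> l + (a2' + x) + (b2' + y)"
    "b2 + v \<le> b2' + y \<or> 2 * (b2 + v) + 2 * X \<le> s + 2 * (b2' + y)"
    "b2 + v \<le> b2' + y \<or> b2 + v + X \<le> l"
    "a2 + u + (b2 + v) \<le> a2' + x + (b2' + y) + X \<or> a2 + u \<le> 2 * X + 3"
    using assms(1) by (simp_all only: balanced_def eq)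
  have n1: "a2 + 2 * b2 \<le> a2' + 2 * b2'" using i(1) assms(6) by simp
  have n2: "2 * b2 + a2 \<le> s + 2 * b2'" using i(2) assms(6) by simp
  have n3: "a2 + 2 * b2 \<le> l + a2' + b2'" using i(3) assms(6) by simp
  have "(b2 \<le> b2' \<or> 2 * b2 + 2 * X \<le> s + 2 * b2') \<and> (b2 \<le> b2' \<or> b2 + X \<le> l) \<and>
     (a2 + b2 \<le> a2' + b2' + X \<or> a2 \<le> 2 * X + 3)"
    using assms(8)
  proof (elim disjE conjE)
    assume t: "take_small l X a b" "v = 0" "x + y \<le> u" "u \<le> 3"
    then have "b2 + X \<le> l" "2 * X + 3 < a2 + u" by (simp_all add: take_small_def eq)
    moreover have "2 * b2 + 2 * X \<le> s + 2 * b2'" using n2 calculation(2) t(4) by simp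
    moreover have "a2 + b2 \<le> a2' + b2' + X \<or> a2 \<le> 2 * X + 3"
      using i(6) t by (elim disjE) auto
    ultimately show ?thesis by simp
  next
    assume t: "y \<le> v" "x + y \<le> u + v"
    show ?thesis
      using i(4-6) t by auto
  next
    assume t: "y \<le> v" "\<not> take_small l X a b"
    have "l < b2 + v + X \<or> a2 + u \<le> 2 * X + 3"
      using t(2) by (auto simp: take_small_def eq)
    \<comment> \<open>By \<open>v \<le> 1\<close>, the strict inequality before the bin becomes
      \<open>l \<le> b2 + X\<close> after it, which is then inserted into \<open>n3\<close>.\<close>
    then have "a2 + b2 \<le> a2' + b2' + X \<or> a2 \<le> 2 * X + 3"
      using n3 assms(7) by auto
    then show ?thesis
      using i(4,5) t(1) by auto
  qed
  then show ?thesis unfolding balanced_def eq using n1 n2 n3 by simp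
qed

text \<open>While \<open>a\<close>, \<open>b\<close> and \<open>a'\<close> are positive, both sides
  use every bin and pay the same, so all excess arises in \<open>loss_terminal\<close>. The case
  \<open>b' = 0\<close> is not terminal, since small items of the optimum still fit into every
  bin.\<close>

lemma loss_run:
  assumes "2 \<le> S" "\<forall>c \<in> set \<sigma>. S \<le> c \<and> c \<le> bigM S" "packs S a' b' \<sigma> p"
    and thr: "good_threshold s l X" and "balanced s l X a b a' b'"
  shows "int (cost \<sigma> (run S l X a b \<sigma>)) \<le> int (cost \<sigma> p) + (2 * int S - 1) * (int X + 3) + 2 * int S"
  using assms(2,3,5)
proof (induction \<sigma> arbitrary: a b a' b' p)
  case Nil
  then show ?case using assms(1) by (cases p) auto
next
  case (Cons c \<sigma>)
  show ?case
  proof (cases "a = 0 \<or> b = 0 \<or> a' = 0")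
    case True
    then show ?thesis using Cons.prems assms(1) thr by (intro loss_terminal)
  next
    case False
    have c: "S \<le> c" "c \<le> bigM S" using Cons.prems by auto
    obtain x y q where p: "p = (x, y) # q" and le: "x \<le> a'" "y \<le> b'"
      and q: "packs S (a' - x) (b' - y) \<sigma> q"
      and ne: "0 < a' \<or> 0 < b' \<and> 2 * S - 1 \<le> c \<longrightarrow> 0 < x + y" and opt: "shape S c x y"
      using packs_ConsE[OF Cons.prems(2) assms(1) c] by blast
    obtain u v where st: "step S l X a b c = (u, v)" by fastforce
    have pos: "0 < a" "0 < b" using False by auto
    note sv = step_vs_shape[OF assms(1) c st opt pos]
    have "balanced s l X (a - u) (b - v) (a' - x) (b' - y)"
      by (rule balanced_step[OF Cons.prems(3) sv(4,5) le sv(1,2,6)])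
    then have IH: "int (cost \<sigma> (run S l X (a - u) (b - v) \<sigma>))
      \<le> int (cost \<sigma> q) + (2 * int S - 1) * (int X + 3) + 2 * int S"
      using Cons.prems(1) q by (intro Cons.IH) auto
    have "cost (c # \<sigma>) (run S l X a b (c # \<sigma>)) = c + cost \<sigma> (run S l X (a - u) (b - v) \<sigma>)"
      using st sv(3) by simp
    moreover have "cost (c # \<sigma>) p = c + cost \<sigma> q" using p ne False by simp
    ultimately show ?thesis using IH by linarith
  qed
qed

section \<open>Choice of the threshold\<close>

text \<open>The product \<open>(2 * S - 1) * (s + 2 * l) / 2\<close> is the total volume minus
  \<open>s / 2\<close>, so \<open>(2 * S - 1) * X\<close> stays within
  \<open>ratio_f s l - 1\<close> times the volume.\<close>

definition threshold :: "nat \<Rightarrow> nat \<Rightarrow> nat" where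
  "threshold s l = nat \<lfloor>(ratio_f s l - 1) * (real s + 2 * real l) / 2\<rfloor>"

lemma ratio_f_ge_1: "1 \<le> ratio_f s l"
  by (simp add: ratio_f_def)

lemma threshold_bounds:
  "real (threshold s l) \<le> (ratio_f s l - 1) * (real s + 2 * real l) / 2"
  "(ratio_f s l - 1) * (real s + 2 * real l) / 2 < real (threshold s l) + 1"
proof -
  have "0 \<le> (ratio_f s l - 1) * (real s + 2 * real l) / 2"
    using ratio_f_ge_1[of s l] by simp
  then show "real (threshold s l) \<le> (ratio_f s l - 1) * (real s + 2 * real l) / 2"
    "(ratio_f s l - 1) * (real s + 2 * real l) / 2 < real (threshold s l) + 1"
    unfolding threshold_def by linarith+
qed

lemma threshold_value:
  assumes "0 < s" "0 < l"
  shows "(ratio_f s l - 1) * (real s + 2 * real l) / 2 =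
    (if real l \<le> real s / 2 then real l / 2
     else if real l \<le> 5 * real s / 6 then (real s + 2 * real l) / 8
     else real s / 3)"
proof -
  have "1 / (2 + real s / real l) * (real s + 2 * real l) = real l"
    using assms by (simp add: field_simps)
  moreover have "2 / (3 + 6 * real l / real s) * (real s + 2 * real l) = 2 * real s / 3"
    using assms by (simp add: field_simps)
  ultimately show ?thesis by (simp add: ratio_f_def)
qed

text \<open>In the first two regimes the second argument of \<open>max\<close> suffices, combined
  with \<open>d + X \<le> l\<close> and \<open>2 * d + 2 * X \<le> s\<close> respectively; in the
  third the latter alone gives \<open>4 * d \<le> 2 * X + 6\<close>.\<close>

lemma good_threshold_threshold:
  assumes "0 < s" "0 < l"
  shows "good_threshold s l (threshold s l)"
  unfolding good_threshold_def
proof (intro allI impI)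
  fix d :: int
  let ?X = "threshold s l"
  assume d: "0 \<le> d \<and> 2 * d + 2 * int ?X \<le> int s \<and> d + int ?X \<le> int l"
  note b = threshold_bounds(2)[of s l, unfolded threshold_value[OF assms]]
  \<comment> \<open>The added constants 2, 8 and 3 come from rounding \<open>X\<close> down by less
    than one.\<close>
  consider "int l \<le> 2 * int ?X + 2" | "int s + 2 * int l \<le> 8 * int ?X + 8" | "int s \<le> 3 * int ?X + 3"
    using b by (auto split: if_splits simp: field_simps)
  then show "4 * d \<le> 2 * int ?X + 6 + max 0 (3 * d - int l + int ?X)"
    using d by cases linarith+
qed

section \<open>Admissible sequences and the competitive bound\<close>

lemma admissible_count:
  assumes "admissible S n \<sigma>"
  shows "n \<le> count_list \<sigma> (bigM S)"
proof -
  let ?t = "drop (length \<sigma> - n) \<sigma>"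
  have "count_list xs y = length xs" if "\<forall>x \<in> set xs. x = y" for xs and y :: nat
    using that by (induction xs) auto
  from this[of ?t "bigM S"] have "count_list ?t (bigM S) = n"
    using assms by (simp add: admissible_def)
  then show ?thesis
    by (metis append_take_drop_id count_list_append le_add2)
qed

theorem theorem1:
  shows "\<exists>(A :: online_alg) (C :: real). C > 0 \<and>
     (\<forall>S s l \<sigma>. 1 < S \<longrightarrow> admissible S (s + l) \<sigma> \<longrightarrow>
         valid_packing S s l \<sigma> (alg_packing A S s l \<sigma>)) \<and>
     (\<forall>S s l \<sigma>. 2 \<le> S \<longrightarrow> 0 < s \<longrightarrow> 0 < l \<longrightarrow> admissible S (s + l) \<sigma> \<longrightarrow>
         real (cost \<sigma> (alg_packing A S s l \<sigma>))
           \<le> ratio_f s l * real (OPT S s l \<sigma>) + C * real S)"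
proof -
  define A :: online_alg where "A = (\<lambda>S s l \<sigma>. last (run S l (threshold s l) s l \<sigma>))"
  have alg: "alg_packing A S s l \<sigma> = run S l (threshold s l) s l \<sigma>" for S s l \<sigma>
    unfolding A_def by (rule alg_packing_run)
  have valid: "packs S s l \<sigma> (run S l (threshold s l) s l \<sigma>)" if "2 \<le> S" "admissible S (s + l) \<sigma>" for S s l \<sigma>
    using that admissible_count[OF that(2)] by (intro run_packs) (auto simp: admissible_def)
  have bound: "real (cost \<sigma> (run S l (threshold s l) s l \<sigma>)) \<le> ratio_f s l * real (OPT S s l \<sigma>) + 8 * real S"
    if S: "2 \<le> S" and pos: "0 < s" "0 < l" and adm: "admissible S (s + l) \<sigma>" for S s l \<sigma>
  proof -
    let ?X = "threshold s l" and ?f = "ratio_f s l"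
    \<comment> \<open>The run itself shows that valid packings exist, so the minimum in
      \<open>OPT\<close> is attained.\<close>
    have "\<exists>c p. valid_packing S s l \<sigma> p \<and> cost \<sigma> p = c"
      using valid[OF S adm] valid_packing_iff_packs by blast
    then have "\<exists>p. valid_packing S s l \<sigma> p \<and> cost \<sigma> p = OPT S s l \<sigma>"
      unfolding OPT_def by (rule LeastI_ex)
    then obtain p where p: "packs S s l \<sigma> p" "cost \<sigma> p = OPT S s l \<sigma>"
      unfolding valid_packing_iff_packs by blast
    have "balanced s l ?X s l s l" by (simp add: balanced_def)
    then have "int (cost \<sigma> (run S l ?X s l \<sigma>)) \<le> int (cost \<sigma> p) + (2 * int S - 1) * (int ?X + 3) + 2 * int S"
      using adm S by (intro loss_run[OF S _ p(1) good_threshold_threshold[OF pos]]) (auto simp: admissible_def)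
    then have loss: "real (cost \<sigma> (run S l ?X s l \<sigma>)) \<le> real (cost \<sigma> p) + (2 * real S - 1) * (real ?X + 3) + 2 * real S"
      by (metis (mono_tags, lifting) of_int_add of_int_diff of_int_le_iff of_int_mult of_int_numeral of_int_of_nat_eq of_int_1)
    have "s * S + l * (2 * S - 1) \<le> cost \<sigma> p"
      using packs_volume[OF p(1)] by (simp add: bigL_def)
    then have "real (s * S + l * (2 * S - 1)) \<le> real (cost \<sigma> p)" by (simp only: of_nat_le_iff)
    then have vol: "real s * real S + real l * (2 * real S - 1) \<le> real (cost \<sigma> p)"
      using S by (simp add: of_nat_diff)
    have "(2 * real S - 1) * real ?X \<le> (2 * real S - 1) * ((?f - 1) * (real s + 2 * real l) / 2)"
      using threshold_bounds(1)[of s l] S by (intro mult_left_mono) auto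
    also have "\<dots> = (?f - 1) * (real s * real S + real l * (2 * real S - 1) - real s / 2)"
      by (simp add: field_simps)
    also have "\<dots> \<le> (?f - 1) * real (cost \<sigma> p)"
      using vol ratio_f_ge_1[of s l] by (intro mult_left_mono) auto
    finally have "(2 * real S - 1) * real ?X \<le> (?f - 1) * real (cost \<sigma> p)" .
    \<comment> \<open>The additive term is \<open>3 * (2 * S - 1) + 2 * S\<close>, at most
      \<open>8 * S\<close>.\<close>
    then show ?thesis using loss p(2) by (simp add: algebra_simps)
  qed
  show ?thesis
    using valid bound by (intro exI[of _ A] exI[of _ 8]) (simp add: alg valid_packing_iff_packs)
qed

end
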